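(* Let $P_d\in\mathbb{Z}$ with $P_d\ge 1$, let $\chi_0\ge 0$, and let $g_0:\mathbb{Z}\to\mathbb{R}$ satisfy: $g_0(t)=0$ for $t<0$, $g_0(0)>0$, $\sum_{t}|g_0(t)|<\infty$, the support of $g_0$ is $\{0,1,2,\dots\}$, and $g_0$ is strictly monotonically decreasing on its support. Put $g(t)=g_0(t-P_d)$ and consider the system $$u(t)=-\mathcal{C}_{g}(\mathrm{rel}_{\chi_0}(u))(t)=-\mathcal{C}_{g_0}(\mathrm{rel}_{\chi_0}(u))(t-P_d),\qquad t\in\mathbb{Z}.\qquad(\ast)$$ Suppose that $$\chi_0<\left(H_{\overline g^{2P_d}}\begin{bmatrix}\mathbf{1}_{P_d}\\-\mathbf{1}_{P_d}\end{bmatrix}\right)_{(P_d)}.$$ If there exists a $2P_d$-periodic self-oscillation $u$ of $(\ast)$ with $\mathrm{rel}_{\chi_0}(u^{2P_d})=[\mathbf{1}_{P_d}^\top,-\mathbf{1}_{P_d}^\top]^\top$, then for every $n\in\mathbb{Z}_{\ge 0}$ such that $P=\frac{2P_d}{2n+1}$ is a (necessarily even) positive integer, there also exists a $P$-periodic self-oscillation $u$ of $(\ast)$ with $\mathrm{rel}_{\chi_0}(u^P)=[\mathbf{1}_{P/2}^\top,-\mathbf{1}_{P/2}^\top]^\top$.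
   Context: Convolution operator: $\mathcal{C}_{g}(x)(t)=\sum_{\tau\in\mathbb{Z}}g(t-\tau)x(\tau)$ for bounded $x:\mathbb{Z}\to\mathbb{R}$. Support: $\mathrm{supp}(g_0)=\{i\in\mathbb{Z}: g_0(i)\neq 0\}$. $\mathbf{1}_n\in\mathbb{R}^n$ is the all-ones vector. Truncation: for a $P$-periodic sequence $x$, $x^P=[x(0),\dots,x(P-1)]^\top\in\mathbb{R}^P$. Periodic summation with period $2P_d$: $\overline g(t)=\sum_{i\in\mathbb{Z}}g(t+2iP_d)$, and $\overline g^{2P_d}=[\overline g(0),\dots,\overline g(2P_d-1)]^\top$. Circulant matrix: for $v\in\mathbb{R}^n$, $H_v\in\mathbb{R}^{n\times n}$ has $(i,j)$ entry $v_{((i-j)\bmod n)+1}$, i.e. its first column is $v$ and each next column is the cyclic down-shift of the previous one. Order statistics: for $v\in\mathbb{R}^n$, $v_{(k)}$ is the $k$-th largest entry, i.e. $v_{(1)}\ge v_{(2)}\ge\dots\ge v_{(n)}$ are the entries of $v$ in non-increasing order. Relay with dead zone: for $\chi_0\ge 0$ and $x\in\mathbb{R}$, $\mathrm{rel}_{\chi_0}(x)=1$ if $x>\chi_0$, $-1$ if $x<-\chi_0$, and $0$ otherwise; applied entrywise to vectors and sequences. Cyclic forward difference: for $v\in\mathbb{R}^n$, $\Delta_c v=[v_2-v_1,\,v_3-v_2,\dots,v_n-v_{n-1},\,v_1-v_n]^\top$. Variation: for $v\neq 0$, $S^-(v)$ is the number of sign changes between consecutive entries of the vector obtained from $v$ by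 deleting all zeros; $S^-(0)=-1$. Cyclic variation: $S_c^-(v)=\max_{1\le i\le n}S^-([v_i,\dots,v_n,v_1,\dots,v_i])$. Self-oscillation: a $P$-periodic sequence $u$ (for some $P\in\mathbb{Z}_{>0}$) satisfying $(\ast)$ with $S_c^-(\Delta_c u^P)\ge 2$. *)

theory Defs
  imports
    "HOL-Analysis.Infinite_Sum"
    "HOL-Library.Periodic_Fun"
    "Jordan_Normal_Form.Matrix"
begin

text \<open>Vectors of \<open>\<real>\<^sup>n\<close> are of type \<^typ>\<open>real vec\<close>, whose entries are indexed
  from \<open>0\<close> to \<open>n - 1\<close>; a one-based entry \<open>v\<^sub>i\<close> is therefore \<open>v $ (i - 1)\<close>.\<close>

definition convolution :: "(int \<Rightarrow> real) \<Rightarrow> (int \<Rightarrow> real) \<Rightarrow> int \<Rightarrow> real" where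
  "convolution g x t = (\<Sum>\<^sub>\<infinity>\<tau>. g (t - \<tau>) * x \<tau>)"

lemma convolution_shift: "convolution (\<lambda>t. g (t - d)) x t = convolution g x (t - d)"
  by (simp add: convolution_def algebra_simps)

definition supp :: "(int \<Rightarrow> real) \<Rightarrow> int set" where
  "supp x = {i. x i \<noteq> 0}"

definition ones :: "nat \<Rightarrow> real vec" where
  "ones n = vec n (\<lambda>_. 1)"

definition truncation :: "(int \<Rightarrow> real) \<Rightarrow> nat \<Rightarrow> real vec" where
  "truncation x P = vec P (\<lambda>i. x (int i))"

definition periodic_summation :: "nat \<Rightarrow> (int \<Rightarrow> real) \<Rightarrow> int \<Rightarrow> real" where
  "periodic_summation T g t = (\<Sum>\<^sub>\<infinity>i. g (t + i * int T))"

text \<open>The difference of the row and the column index is taken in \<^typ>\<open>int\<close>, as subtraction on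
  \<^typ>\<open>nat\<close> is truncated.\<close>

definition circulant :: "real vec \<Rightarrow> real mat" where
  "circulant v = (let n = dim_vec v in
     mat n n (\<lambda>(i, j). v $ nat ((int i - int j) mod int n)))"

text \<open>\<open>order_stat k v\<close> is the \<open>k\<close>-th largest entry of \<open>v\<close>, meaningful for
  \<open>1 \<le> k \<le> dim_vec v\<close>.\<close>

definition order_stat :: "nat \<Rightarrow> real vec \<Rightarrow> real" where
  "order_stat k v = rev (sort (list_of_vec v)) ! (k - 1)"

definition rel :: "real \<Rightarrow> real \<Rightarrow> real" where
  "rel \<chi> x = (if x > \<chi> then 1 else if x < - \<chi> then - 1 else 0)"

definition cyclic_diff :: "real vec \<Rightarrow> real vec" where
  "cyclic_diff v = (let n = dim_vec v in vec n (\<lambda>i. v $ (Suc i mod n) - v $ i))"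

definition variation :: "real vec \<Rightarrow> int" where
  "variation v =
     (if v = 0\<^sub>v (dim_vec v) then - 1
      else let ws = filter (\<lambda>a. a \<noteq> 0) (list_of_vec v)
           in int (card {i. Suc i < length ws \<and> sgn (ws ! i) \<noteq> sgn (ws ! Suc i)}))"

text \<open>The vector of length \<open>n + 1\<close> below is \<open>[v\<^sub>i, \<dots>, v\<^sub>n, v\<^sub>1, \<dots>, v\<^sub>i]\<close> (up to the index shift), with
  the starting entry repeated at the end.\<close>

definition cyclic_variation :: "real vec \<Rightarrow> int" where
  "cyclic_variation v = (let n = dim_vec v in
     Max ((\<lambda>i. variation (vec (Suc n) (\<lambda>j. v $ ((i + j) mod n)))) ` {..<n}))"

text \<open>\<open>P\<close> is a period of \<open>u\<close>, not necessarily the minimal one.\<close>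

definition self_oscillation ::
  "real \<Rightarrow> (int \<Rightarrow> real) \<Rightarrow> nat \<Rightarrow> (int \<Rightarrow> real) \<Rightarrow> bool" where
  "self_oscillation \<chi> g P u \<longleftrightarrow>
     P > 0 \<and> periodic_fun_simple u (int P) \<and>
     (\<forall>t. u t = - convolution g (\<lambda>\<tau>. rel \<chi> (u \<tau>)) t) \<and>
     cyclic_variation (cyclic_diff (truncation u P)) \<ge> 2"

end

theory Submission
  imports Defs
begin

text \<open>Write \<open>s\<^sub>h\<close> for the \<open>\<plusminus>1\<close> square wave with half-period \<open>h\<close>.  A \<open>2h\<close>-periodic signal \<open>u\<close>
  whose relay output over one period is \<open>h\<close> ones followed by \<open>h\<close> minus ones has relay output
  \<open>s\<^sub>h\<close>, so the loop equation forces \<open>u = - C\<^sub>g(s\<^sub>h)\<close>.  If \<open>P\<^sub>d = m h\<close> with \<open>m\<close> odd, delaying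
  \<open>s\<^sub>h\<close> by \<open>P\<^sub>d\<close> changes its sign; the delay and the negative feedback cancel, and the
  candidate is \<open>U\<^sub>h = C\<^sub>g\<^sub>0(s\<^sub>h)\<close>.  It is a self-oscillation as soon as
  \<open>U\<^sub>h(t) > \<chi>\<^sub>0\<close> for \<open>0 \<le> t < h\<close>: antiperiodicity gives \<open>U\<^sub>h < - \<chi>\<^sub>0\<close> on the other half of the
  period, and a nonconstant cyclic vector has a cyclic difference that changes sign at least
  twice.

  The given oscillation of period \<open>2P\<^sub>d\<close> is \<open>U\<^bsub>mh\<^esub>\<close>, whence \<open>U\<^bsub>mh\<^esub>(0) > \<chi>\<^sub>0\<close>, and it remains to
  compare: \<open>U\<^sub>h(t) \<ge> U\<^bsub>mh\<^esub>(0)\<close> for \<open>0 \<le> t < h\<close> (\<open>square_wave_response_le\<close>).  The difference is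
  \<open>\<Sum>\<^sub>k g\<^sub>0(k) w(k)\<close> with \<open>w(k) = s\<^sub>h(t - k) - s\<^bsub>mh\<^esub>(-k)\<close>.  Seen backwards from \<open>0\<close>, the slow wave
  \<open>s\<^bsub>mh\<^esub>\<close> is \<open>-1\<close> throughout the first half-period after \<open>k = 0\<close>, so \<open>w \<ge> 0\<close> on the first \<open>mh\<close>
  indices; and as \<open>m\<close> is odd, \<open>w(k + mh) = - w(k)\<close>.  Each nonnegative stretch of \<open>w\<close> is thus
  followed by its own negative, which is weighted by smaller values of the decreasing \<open>g\<^sub>0\<close>, and
  the sum is nonnegative (\<open>antiperiodic_weighted_sum_nonneg\<close>).\<close>

section \<open>Antiperiodic weights\<close>

text \<open>Pair the index \<open>k\<close> in the first half of a period with \<open>k + q\<close> in the second half: the two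
  terms add up to \<open>(f k - f (k + q)) * w k\<close>, a product of nonnegative factors.\<close>

lemma antiperiodic_weighted_sum_nonneg:
  fixes f w :: "nat \<Rightarrow> real"
  assumes sums: "(\<lambda>k. f k * w k) sums S"
    and f: "decseq f"
    and antiperiodic: "\<And>k. w (k + q) = - w k"
    and nonneg: "\<And>k. k < q \<Longrightarrow> w k \<ge> 0"
    and "q > 0"
  shows "S \<ge> 0"
proof -
  have periodic: "w (r + i * (2 * q)) = w r" for r i
  proof (induction i)
    case (Suc i)
    have "w (r + Suc i * (2 * q)) = w (r + i * (2 * q) + q + q)"
      by (simp add: algebra_simps)
    then show ?case
      using Suc by (simp only: antiperiodic minus_minus)
  qed simp
  have block: "(\<Sum>k = i * (2 * q)..<i * (2 * q) + 2 * q. f k * w k) \<ge> 0" for i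
  proof -
    define a where "a = i * (2 * q)"
    have "(\<Sum>k = a..<a + 2 * q. f k * w k)
        = (\<Sum>k = a..<a + q. f k * w k) + (\<Sum>k = a + q..<(a + q) + q. f k * w k)"
      by (subst sum.atLeastLessThan_concat) (simp_all add: mult_2 add.assoc)
    also have "\<dots> = (\<Sum>k = a..<a + q. f k * w k) + (\<Sum>k = a..<a + q. f (k + q) * w (k + q))"
      by (simp only: sum.shift_bounds_nat_ivl)
    also have "\<dots> = (\<Sum>k = a..<a + q. (f k - f (k + q)) * w k)"
      by (simp add: antiperiodic sum.distrib[symmetric] algebra_simps)
    also have "\<dots> \<ge> 0"
    proof (rule sum_nonneg)
      fix k assume k: "k \<in> {a..<a + q}"
      have "w k = w (k - a)"
        using periodic[of "k - a" i] k by (simp add: a_def)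
      then have "w k \<ge> 0"
        using nonneg[of "k - a"] k by auto
      moreover have "f (k + q) \<le> f k"
        using f by (simp add: decseqD)
      ultimately show "(f k - f (k + q)) * w k \<ge> 0"
        by simp
    qed
    finally show ?thesis
      by (simp add: a_def)
  qed
  have "(\<lambda>i. \<Sum>k = i * (2 * q)..<i * (2 * q) + 2 * q. f k * w k) sums S"
    using sums_group[OF sums, of "2 * q"] \<open>q > 0\<close> by simp
  from sums_le[OF block sums_zero this] show ?thesis .
qed

section \<open>Square waves\<close>

text \<open>The parity of the index of the half-period containing \<open>t\<close> determines the value; in this
  form a shift by \<open>m\<close> half-periods adds \<open>m\<close> to the index.\<close>

definition square_wave :: "nat \<Rightarrow> int \<Rightarrow> real" where
  "square_wave h t = (if even (t div int h) then 1 else - 1)"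

lemma abs_square_wave: "\<bar>square_wave h t\<bar> = 1"
  by (simp add: square_wave_def)

lemma square_wave_eq_1: "0 \<le> t \<Longrightarrow> t < int h \<Longrightarrow> square_wave h t = 1"
  by (simp add: square_wave_def)

lemma square_wave_add_odd:
  assumes "h > 0" "odd m"
  shows "square_wave h (t + int (m * h)) = - square_wave h t"
proof -
  have "(t + int (m * h)) div int h = t div int h + int m"
    using assms by simp
  then show ?thesis
    using assms by (simp add: square_wave_def)
qed

lemma square_wave_diff_odd:
  assumes "h > 0" "odd m"
  shows "square_wave h (t - int (m * h)) = - square_wave h t"
  using square_wave_add_odd[OF assms, of "t - int (m * h)"] by simp

lemma square_wave_antiperiodic:
  "h > 0 \<Longrightarrow> square_wave h (t + int h) = - square_wave h t"
  using square_wave_add_odd[of h 1] by simp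

lemma square_wave_eq_minus_1:
  assumes "int h \<le> t" "t < 2 * int h"
  shows "square_wave h t = - 1"
  using square_wave_antiperiodic[of h "t - int h"] square_wave_eq_1[of "t - int h" h] assms by simp

lemma square_wave_neg_eq_minus_1:
  assumes "- int h \<le> t" "t < 0"
  shows "square_wave h t = - 1"
  using square_wave_antiperiodic[of h t] square_wave_eq_1[of "t + int h" h] assms by simp

lemma periodic_mod:
  fixes u :: "int \<Rightarrow> real"
  assumes "periodic_fun_simple u p"
  shows "u (t mod p) = u t"
proof -
  interpret periodic_fun_simple u p by fact
  show ?thesis
    using plus_of_int[of "t mod p" "t div p"] by simp
qed

lemma periodic_square_wave: "h > 0 \<Longrightarrow> periodic_fun_simple (square_wave h) (int (2 * h))"
proof
  fix t assume "h > 0"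
  then show "square_wave h (t + int (2 * h)) = square_wave h t"
    using square_wave_antiperiodic[of h t] square_wave_antiperiodic[of h "t + int h"]
    by (simp add: algebra_simps)
qed

text \<open>This passes between the relay output over a single period, as a vector, and the relay
  output as a sequence, which is what enters the convolution.\<close>

lemma rel_truncation_eq_iff:
  assumes h: "h > 0" and u: "periodic_fun_simple u (int (2 * h))"
  shows "map_vec (rel \<chi>) (truncation u (2 * h)) = ones h @\<^sub>v - ones h
    \<longleftrightarrow> (\<forall>t. rel \<chi> (u t) = square_wave h t)" (is "?vec \<longleftrightarrow> ?all")
proof -
  have entry: "(ones h @\<^sub>v - ones h) $ i = square_wave h (int i)" if "i < 2 * h" for i
    using that by (auto simp: ones_def square_wave_eq_1 square_wave_eq_minus_1)
  have "?vec \<longleftrightarrow> (\<forall>i < 2 * h. rel \<chi> (u (int i)) = square_wave h (int i))"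
    using entry by (auto simp: vec_eq_iff truncation_def ones_def)
  also have "\<dots> \<longleftrightarrow> ?all"
  proof (intro iffI allI)
    fix t
    assume *: "\<forall>i < 2 * h. rel \<chi> (u (int i)) = square_wave h (int i)"
    define i where "i = nat (t mod int (2 * h))"
    have i: "int i = t mod int (2 * h)" and "i < 2 * h"
      using h pos_mod_bound[of "int (2 * h)" t] by (simp_all add: i_def nat_less_iff)
    with * show "rel \<chi> (u t) = square_wave h t"
      using periodic_mod[OF u, of t] periodic_mod[OF periodic_square_wave[OF h], of t] by metis
  qed simp
  finally show ?thesis .
qed

section \<open>Causal convolution with square waves\<close>

text \<open>Substituting \<open>k = t - \<tau>\<close> moves the shift from the kernel to the input and leaves a series over
  the natural numbers, whose terms can be grouped in blocks.\<close>

lemma causal_convolution_sums: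
  fixes g x :: "int \<Rightarrow> real"
  assumes summable: "(\<lambda>t. \<bar>g t\<bar>) summable_on UNIV"
    and causal: "\<And>t. t < 0 \<Longrightarrow> g t = 0"
    and bounded: "\<And>t. \<bar>x t\<bar> \<le> B"
  shows "(\<lambda>k. g (int k) * x (t - int k)) sums convolution g x t"
proof -
  have bij: "bij_betw (\<lambda>k::int. t - k) UNIV UNIV"
    by (rule bij_betw_byWitness[where f' = "\<lambda>k. t - k"]) auto
  have bij_int: "bij_betw int UNIV {0..}"
    by (rule bij_betw_byWitness[where f' = nat]) auto
  have "(\<lambda>k. B * \<bar>g k\<bar>) summable_on UNIV"
    by (intro summable_on_cmult_right summable)
  then have "(\<lambda>k. norm (g k * x (t - k))) summable_on UNIV"
  proof (rule abs_summable_on_comparison_test')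
    show "norm (g k * x (t - k)) \<le> B * \<bar>g k\<bar>" for k
      using mult_left_mono[OF bounded, of "\<bar>g k\<bar>" "t - k"] by (simp add: abs_mult mult.commute)
  qed
  then have "(\<lambda>k. g k * x (t - k)) summable_on UNIV"
    by (rule abs_summable_summable)
  then have "((\<lambda>k. g k * x (t - k)) has_sum (\<Sum>\<^sub>\<infinity>k. g k * x (t - k))) UNIV"
    by simp
  also have "(\<Sum>\<^sub>\<infinity>k. g k * x (t - k)) = convolution g x t"
    unfolding convolution_def
    using infsum_reindex_bij_betw[OF bij, of "\<lambda>\<tau>. g (t - \<tau>) * x \<tau>"] by simp
  also have "((\<lambda>k. g k * x (t - k)) has_sum convolution g x t) UNIV
      \<longleftrightarrow> ((\<lambda>k. g k * x (t - k)) has_sum convolution g x t) {0..}"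
    by (rule has_sum_cong_neutral) (auto simp: causal)
  also have "\<dots> \<longleftrightarrow> ((\<lambda>k. g (int k) * x (t - int k)) has_sum convolution g x t) UNIV"
    by (rule has_sum_reindex_bij_betw[OF bij_int, symmetric])
  finally show ?thesis
    by (rule has_sum_imp_sums)
qed

lemma convolution_negate_shift:
  fixes g x :: "int \<Rightarrow> real"
  assumes "(\<lambda>t. \<bar>g t\<bar>) summable_on UNIV"
    and "\<And>t. t < 0 \<Longrightarrow> g t = 0"
    and "\<And>t. \<bar>x t\<bar> \<le> B"
    and antiperiodic: "\<And>t. x (t - d) = - x t"
  shows "convolution g x (t - d) = - convolution g x t"
proof -
  have sums: "(\<lambda>k. g (int k) * x (s - int k)) sums convolution g x s" for s
    using assms(1-3) by (rule causal_convolution_sums)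
  have "x (t - d - s) = - x (t - s)" for s
    using antiperiodic[of "t - s"] by (simp add: algebra_simps)
  then have "(\<lambda>k. - (g (int k) * x (t - int k))) sums convolution g x (t - d)"
    using sums[of "t - d"] by simp
  from sums_unique2[OF this sums_minus[OF sums[of t]]] show ?thesis .
qed

text \<open>The comparison of a fast with a slow square wave.  Evaluating the slow response at \<open>0\<close>,
  just after the wave has switched to \<open>1\<close>, makes it collect the value \<open>-1\<close> against the largest
  coefficients \<open>g 1, g 2, \<dots>\<close>; the first coefficient \<open>g 0\<close> meets the value \<open>1\<close> in both
  responses.\<close>

lemma square_wave_response_le:
  assumes summable: "(\<lambda>t. \<bar>g t\<bar>) summable_on UNIV"
    and causal: "\<And>t. t < 0 \<Longrightarrow> g t = 0"
    and decreasing: "antimono_on {0..} g"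
    and "odd m" and t: "0 \<le> t" "t < int h"
  shows "convolution g (square_wave (m * h)) 0 \<le> convolution g (square_wave h) t"
proof -
  define w where "w k = square_wave h (t - int k) - square_wave (m * h) (0 - int k)" for k
  have h: "h > 0" and mh: "m * h > 0"
    using t \<open>odd m\<close> by (auto intro!: Nat.gr0I)
  note sums = causal_convolution_sums[OF summable causal, where B = 1]
  have "(\<lambda>k. g (int k) * w k) sums
      (convolution g (square_wave h) t - convolution g (square_wave (m * h)) 0)"
    unfolding w_def right_diff_distrib by (intro sums_diff sums) (simp_all add: abs_square_wave)
  then have "convolution g (square_wave h) t - convolution g (square_wave (m * h)) 0 \<ge> 0"
  proof (rule antiperiodic_weighted_sum_nonneg)
    show "decseq (\<lambda>k. g (int k))"
      using decreasing by (auto simp: monotone_on_def)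
    show "w (k + m * h) = - w k" for k
      using square_wave_diff_odd[OF h \<open>odd m\<close>, of "t - int k"]
        square_wave_diff_odd[OF mh odd_one, of "0 - int k"]
      by (simp add: w_def algebra_simps)
    \<comment> \<open>At \<open>k = 0\<close> both waves are \<open>1\<close>; from \<open>k = 1\<close> on the slow wave is at its minimum.\<close>
    show "w k \<ge> 0" if "k < m * h" for k
    proof (cases "k = 0")
      case True
      then show ?thesis
        using t mh by (simp add: w_def square_wave_eq_1)
    next
      case False
      then have "square_wave (m * h) (0 - int k) = - 1"
        using that by (intro square_wave_neg_eq_minus_1) (simp_all flip: of_nat_mult)
      then show ?thesis
        using abs_square_wave[of h "t - int k"] by (simp add: w_def)
    qed
  qed fact
  then show ?thesis
    by simp
qed

section \<open>Cyclic variation\<close>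

text \<open>Between two entries of different sign there is a sign change, hence one on either side of a
  negative entry that lies between two positive ones.\<close>

lemma card_sign_changes_ge_2:
  fixes ws :: "real list"
  assumes "y \<in> set ws" "y < 0" "x > 0" "z > 0"
  defines "xs \<equiv> x # ws @ [z]"
  shows "card {i. Suc i < length xs \<and> sgn (xs ! i) \<noteq> sgn (xs ! Suc i)} \<ge> 2"
proof -
  have change: "\<exists>i. a \<le> i \<and> i < b \<and> sgn (xs ! i) \<noteq> sgn (xs ! Suc i)"
    if "a \<le> b" "sgn (xs ! a) \<noteq> sgn (xs ! b)" for a b
    using that
  proof (induction b rule: dec_induct)
    case (step n)
    then show ?case
      by (cases "sgn (xs ! a) = sgn (xs ! n)") (auto intro: less_SucI)
  qed simp
  from assms(1) obtain j where j: "j < length ws" "ws ! j = y"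
    by (auto simp: in_set_conv_nth)
  have entries: "xs ! 0 = x" "xs ! Suc j = y" "xs ! Suc (length ws) = z"
    using j by (simp_all add: xs_def nth_append)
  obtain a where a: "a < Suc j" "sgn (xs ! a) \<noteq> sgn (xs ! Suc a)"
    using change[of 0 "Suc j"] entries assms(2,3) by auto
  obtain b where b: "Suc j \<le> b" "b < Suc (length ws)" "sgn (xs ! b) \<noteq> sgn (xs ! Suc b)"
    using change[of "Suc j" "Suc (length ws)"] entries assms(2,4) j by auto
  have "card {a, b} \<le> card {i. Suc i < length xs \<and> sgn (xs ! i) \<noteq> sgn (xs ! Suc i)}"
    using a b j by (intro card_mono) (auto simp: xs_def)
  with a b show ?thesis
    by simp
qed

text \<open>Among the rotations over which the maximum is taken, the one that starts at the positive entry
  also ends there, and the negative entry lies strictly inside it.\<close>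

lemma cyclic_variation_ge_2:
  assumes i: "i < dim_vec d" "d $ i > 0" and j: "j < dim_vec d" "d $ j < 0"
  shows "cyclic_variation d \<ge> 2"
proof -
  define n where "n = dim_vec d"
  define r where "r k = d $ ((i + k) mod n)" for k
  define ws where "ws = filter (\<lambda>a. a \<noteq> 0) (map r [1..<n])"
  have n: "n > 0"
    using i by (simp add: n_def)
  have ends: "r 0 = d $ i" "r n = d $ i"
    using i by (simp_all add: r_def n_def)
  have "[0..<Suc n] = 0 # [1..<n] @ [n]"
    using n by (simp add: upt_conv_Cons)
  then have list: "filter (\<lambda>a. a \<noteq> 0) (list_of_vec (vec (Suc n) r)) = d $ i # ws @ [d $ i]"
    using i ends by (simp add: ws_def list_of_vec_vec)
  have "d $ j \<in> set ws"
  proof -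
    define k where "k = (if i \<le> j then j - i else j + n - i)"
    have k: "(i + k) mod n = j" "k < n"
      using i j by (auto simp: k_def n_def)
    then have "k \<noteq> 0"
      using i j by (cases "k = 0") (auto simp: n_def)
    with k j show ?thesis
      by (auto simp: ws_def r_def image_iff intro!: bexI[of _ k])
  qed
  from card_sign_changes_ge_2[OF this j(2) i(2) i(2)]
  have "variation (vec (Suc n) r) \<ge> 2"
  proof -
    have "vec (Suc n) r \<noteq> 0\<^sub>v (dim_vec (vec (Suc n) r))"
      using ends i by (auto simp: vec_eq_iff)
    then show ?thesis
      using \<open>2 \<le> card _\<close> by (simp only: variation_def list Let_def if_False)
  qed
  also have "variation (vec (Suc n) r) \<le> cyclic_variation d"
    using i by (auto simp: cyclic_variation_def Let_def n_def[symmetric] r_def[abs_def]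
      intro!: Max_ge)
  finally show ?thesis .
qed

text \<open>Going round the cycle from \<open>i\<close> one reaches every \<open>j\<close>.  Used in both directions, this makes a
  cyclically monotone vector constant, so the cyclic difference of a nonconstant vector takes
  both signs.\<close>

lemma cyclically_increasing_imp_le:
  fixes f :: "nat \<Rightarrow> real"
  assumes step: "\<And>i. i < n \<Longrightarrow> f i \<le> f (Suc i mod n)" and "i < n" "j < n"
  shows "f i \<le> f j"
proof -
  have "f i \<le> f ((i + k) mod n)" for k
  proof (induction k)
    case (Suc k)
    also have "f ((i + k) mod n) \<le> f (Suc ((i + k) mod n) mod n)"
      using \<open>i < n\<close> by (intro step) simp
    finally show ?case
      by (simp add: mod_Suc_eq)
  qed (use \<open>i < n\<close> in simp)
  from this[of "j + n - i"] show ?thesis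
    using assms by simp
qed

lemma cyclic_variation_cyclic_diff_ge_2:
  assumes "i < dim_vec v" "j < dim_vec v" "v $ i \<noteq> v $ j"
  shows "cyclic_variation (cyclic_diff v) \<ge> 2"
proof -
  define n where "n = dim_vec v"
  have diff: "cyclic_diff v $ k = v $ (Suc k mod n) - v $ k" if "k < n" for k
    using that by (simp add: cyclic_diff_def Let_def n_def)
  have dim: "dim_vec (cyclic_diff v) = n"
    by (simp add: cyclic_diff_def Let_def n_def)
  have n: "i < n" "j < n"
    using assms by (simp_all add: n_def)
  have "\<exists>a<n. cyclic_diff v $ a > 0"
  proof (rule ccontr)
    assume "\<not> ?thesis"
    then have "- v $ k \<le> - v $ (Suc k mod n)" if "k < n" for k
      using that diff[of k] by force
    from cyclically_increasing_imp_le[of n "\<lambda>k. - v $ k", OF this n]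
      cyclically_increasing_imp_le[of n "\<lambda>k. - v $ k", OF this n(2,1)] show False
      using assms(3) by simp
  qed
  moreover have "\<exists>b<n. cyclic_diff v $ b < 0"
  proof (rule ccontr)
    assume "\<not> ?thesis"
    then have "v $ k \<le> v $ (Suc k mod n)" if "k < n" for k
      using that diff[of k] by force
    from cyclically_increasing_imp_le[of n "\<lambda>k. v $ k", OF this n]
      cyclically_increasing_imp_le[of n "\<lambda>k. v $ k", OF this n(2,1)] show False
      using assms(3) by simp
  qed
  ultimately show ?thesis
    using dim cyclic_variation_ge_2 by metis
qed

section \<open>Self-oscillations\<close>

text \<open>The delay \<open>m * h\<close> is an odd number of half-periods and acts on the square wave as a change of
  sign, which undoes the sign of the feedback.  A self-oscillation therefore only needs the
  undelayed response to exceed the threshold on the first half-period.\<close>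

lemma self_oscillation_square_wave:
  assumes summable: "(\<lambda>t. \<bar>g\<^sub>0 t\<bar>) summable_on UNIV"
    and causal: "\<And>t. t < 0 \<Longrightarrow> g\<^sub>0 t = 0"
    and "odd m" "h > 0" "\<chi> \<ge> 0"
    and large: "\<And>t. 0 \<le> t \<Longrightarrow> t < int h \<Longrightarrow> \<chi> < convolution g\<^sub>0 (square_wave h) t"
  defines "u \<equiv> convolution g\<^sub>0 (square_wave h)"
  shows "self_oscillation \<chi> (\<lambda>t. g\<^sub>0 (t - int (m * h))) (2 * h) u"
    and "map_vec (rel \<chi>) (truncation u (2 * h)) = ones h @\<^sub>v - ones h"
proof -
  have shift: "u (t - int (k * h)) = - u t" if "odd k" for t k
    unfolding u_def using summable causal
    by (rule convolution_negate_shift[where B = 1])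
       (simp_all only: abs_square_wave order_refl square_wave_diff_odd[OF \<open>h > 0\<close> that])
  have antiperiodic: "u (t + int h) = - u t" for t
    using shift[of 1 "t + int h"] by simp
  have periodic: "periodic_fun_simple u (int (2 * h))"
  proof
    show "u (t + int (2 * h)) = u t" for t
      using antiperiodic[of t] antiperiodic[of "t + int h"] by (simp add: algebra_simps)
  qed
  have pos: "u t > \<chi>" if "0 \<le> t" "t < int h" for t
    using large[OF that] by (simp add: u_def)
  have neg: "u t < - \<chi>" if "int h \<le> t" "t < 2 * int h" for t
    using pos[of "t - int h"] antiperiodic[of "t - int h"] that by simp
  have "rel \<chi> (u (int i)) = (ones h @\<^sub>v - ones h) $ i" if "i < 2 * h" for i
    using pos[of "int i"] neg[of "int i"] that \<open>\<chi> \<ge> 0\<close>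
    by (cases "i < h") (auto simp: rel_def ones_def)
  then show vec: "map_vec (rel \<chi>) (truncation u (2 * h)) = ones h @\<^sub>v - ones h"
    by (auto simp: vec_eq_iff truncation_def ones_def)
  then have rel: "rel \<chi> (u t) = square_wave h t" for t
    using rel_truncation_eq_iff[OF \<open>h > 0\<close> periodic] by blast
  have "u t = - convolution (\<lambda>t. g\<^sub>0 (t - int (m * h))) (\<lambda>\<tau>. rel \<chi> (u \<tau>)) t" for t
    using shift[OF \<open>odd m\<close>, of t] by (simp only: rel convolution_shift) (simp add: u_def)
  moreover have "cyclic_variation (cyclic_diff (truncation u (2 * h))) \<ge> 2"
    using pos[of 0] neg[of "int h"] \<open>h > 0\<close> \<open>\<chi> \<ge> 0\<close>
    by (intro cyclic_variation_cyclic_diff_ge_2[of 0 _ h]) (simp_all add: truncation_def)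
  ultimately show "self_oscillation \<chi> (\<lambda>t. g\<^sub>0 (t - int (m * h))) (2 * h) u"
    using periodic \<open>h > 0\<close> unfolding self_oscillation_def by (intro conjI allI) linarith+
qed

theorem corollary1:
  fixes P\<^sub>d :: nat and \<chi>\<^sub>0 :: real and g\<^sub>0 g :: "int \<Rightarrow> real"
  assumes "P\<^sub>d \<ge> 1"
    and "\<chi>\<^sub>0 \<ge> 0"
    and "\<And>t. t < 0 \<Longrightarrow> g\<^sub>0 t = 0"
    and "g\<^sub>0 0 > 0"
    and "(\<lambda>t. \<bar>g\<^sub>0 t\<bar>) summable_on UNIV"
    and "supp g\<^sub>0 = {0..}"
    and "strict_antimono_on (supp g\<^sub>0) g\<^sub>0"
    and "g = (\<lambda>t. g\<^sub>0 (t - int P\<^sub>d))"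
    and "\<chi>\<^sub>0 < order_stat P\<^sub>d
           (circulant (truncation (periodic_summation (2 * P\<^sub>d) g) (2 * P\<^sub>d))
              *\<^sub>v (ones P\<^sub>d @\<^sub>v - ones P\<^sub>d))"
    and "\<exists>u. self_oscillation \<chi>\<^sub>0 g (2 * P\<^sub>d) u \<and>
           map_vec (rel \<chi>\<^sub>0) (truncation u (2 * P\<^sub>d)) = ones P\<^sub>d @\<^sub>v - ones P\<^sub>d"
  shows "\<forall>n P :: nat. P > 0 \<and> real P = real (2 * P\<^sub>d) / real (2 * n + 1) \<longrightarrow>
           even P \<and>
           (\<exists>u. self_oscillation \<chi>\<^sub>0 g P u \<and>
              map_vec (rel \<chi>\<^sub>0) (truncation u P) = ones (P div 2) @\<^sub>v - ones (P div 2))"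
proof (intro allI impI)
  fix n P :: nat
  assume P: "P > 0 \<and> real P = real (2 * P\<^sub>d) / real (2 * n + 1)"
  define m where "m = 2 * n + 1"
  define h where "h = P div 2"
  have "odd m"
    by (simp add: m_def)
  have "real (P * m) = real (2 * P\<^sub>d)"
    using P \<open>odd m\<close> unfolding m_def[symmetric] by (cases "m = 0") (simp_all add: field_simps)
  then have Pm: "P * m = 2 * P\<^sub>d"
    by (simp only: of_nat_eq_iff)
  then have "even P"
    using \<open>odd m\<close> even_mult_iff[of P m] by simp
  then have P_eq: "P = 2 * h"
    by (simp add: h_def)
  then have h: "h > 0" and Pd: "P\<^sub>d = m * h"
    using P Pm by (auto simp: mult.commute)
  have decreasing: "antimono_on {0..} g\<^sub>0"
    using assms(6,7) by (auto simp: monotone_on_def order_le_less)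
  obtain v where v: "self_oscillation \<chi>\<^sub>0 g (2 * P\<^sub>d) v"
      "map_vec (rel \<chi>\<^sub>0) (truncation v (2 * P\<^sub>d)) = ones P\<^sub>d @\<^sub>v - ones P\<^sub>d"
    using assms(10) by blast
  have "periodic_fun_simple v (int (2 * P\<^sub>d))"
    using v(1) unfolding self_oscillation_def by blast
  then have rel_v: "rel \<chi>\<^sub>0 (v t) = square_wave P\<^sub>d t" for t
    using rel_truncation_eq_iff[of P\<^sub>d v \<chi>\<^sub>0] v(2) assms(1) by auto
  have "v 0 = - convolution g (square_wave P\<^sub>d) 0"
    using v(1) unfolding self_oscillation_def rel_v by blast
  also have "\<dots> = - convolution g\<^sub>0 (square_wave P\<^sub>d) (0 - int P\<^sub>d)"
    unfolding assms(8) by (simp only: convolution_shift)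
  also have "\<dots> = convolution g\<^sub>0 (square_wave P\<^sub>d) 0"
    using convolution_negate_shift[OF assms(5,3), of "square_wave P\<^sub>d" 1 "int P\<^sub>d" 0]
      square_wave_diff_odd[of P\<^sub>d 1] assms(1) by (simp add: abs_square_wave)
  finally have "convolution g\<^sub>0 (square_wave P\<^sub>d) 0 = v 0" ..
  moreover have "v 0 > \<chi>\<^sub>0"
    using rel_v[of 0] assms(1) by (simp add: rel_def square_wave_eq_1 split: if_splits)
  ultimately have large: "\<chi>\<^sub>0 < convolution g\<^sub>0 (square_wave h) t" if "0 \<le> t" "t < int h" for t
    using square_wave_response_le[OF assms(5,3) decreasing \<open>odd m\<close> that] by (simp add: Pd)
  have "\<exists>u. self_oscillation \<chi>\<^sub>0 g P u \<and>
      map_vec (rel \<chi>\<^sub>0) (truncation u P) = ones (P div 2) @\<^sub>v - ones (P div 2)"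
    using self_oscillation_square_wave[OF assms(5,3) \<open>odd m\<close> h assms(2) large]
    unfolding assms(8) Pd P_eq by auto
  with \<open>even P\<close> show "even P \<and> (\<exists>u. self_oscillation \<chi>\<^sub>0 g P u \<and>
      map_vec (rel \<chi>\<^sub>0) (truncation u P) = ones (P div 2) @\<^sub>v - ones (P div 2))" ..
qed

end
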